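(* Put $\kappa:=\frac{(1-q)^2}{(1+q)(1+q^3)}$ and $$F_q(z):=\sum_{m=0}^\infty(-1)^mq^{m(m+2)}z^m\frac{(\kappa q;q^2)_m}{(q^2;q^2)_m}.$$ Then $F_q(z)$ is the unique element of $1+z\mathbb Q(q)[[z]]$ satisfying $$F_q(z)=(1-q^3z)F_q(q^2z)+\kappa q^4z\,F_q(q^4z).$$ Moreover, for Euler's number $e$, $$[e]_q=\frac{(1+q^3)[3]_qF_q(1)+q^3(1-q)F_q(q^2)}{(1+q^3)F_q(1)+q^2(1-q)F_q(q^2)}.$$ Equivalently, if $$R_q:=\frac{1+q^3}{1-q}\cdot\frac{F_q(1)}{F_q(q^2)},$$ then $$[e]_q=\frac{[3]_qR_q+q^3}{R_q+q^2}.$$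
   Context: $[n]_q=\frac{1-q^n}{1-q}$ and $(a;Q)_m:=\prod_{j=0}^{m-1}(1-aQ^j)$. In terms of the confluent basic hypergeometric series ${}_1\phi_1(a;b;Q,t)=\sum_{m\ge0}\frac{(a;Q)_m}{(b;Q)_m(Q;Q)_m}(-1)^mQ^{\binom m2}t^m$ one has $F_q(z)={}_1\phi_1(\kappa q;0;q^2,q^3z)$. For real $x\ge1$ write uniquely $x=[[c_1,c_2,\ldots]]:=c_1-\frac{1}{c_2-\frac{1}{c_3-\cdots}}$ with integers $c_j\ge2$; then the $q$-real number $[x]_q\in\mathbb Z[[q]]$ is the $q$-adic limit as $N\to\infty$ of $[c_1]_q-\frac{q^{c_1-1}}{[c_2]_q-\cdots\frac{q^{c_{N-1}-1}}{[c_N]_q}}$. The formulas for $[e]_q$ are identities of formal power series in $q$; the series for $F_q(1)$ and $F_q(q^2)$ converge $q$-adically. *)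

theory Defs
  imports Complex_Main "HOL-Computational_Algebra.Computational_Algebra"
begin

section \<open>q-integers and q-Pochhammer symbols\<close>

text \<open>
  The algebraic expressions in \<open>q\<close> are written for an arbitrary commutative ring with a division
  operator, because they are used in two places: in the field \<open>\<rat>(q)\<close>, realised as
  \<^typ>\<open>rat poly fract\<close> with \<open>q = ratq\<close>, and in \<open>\<rat>[[q]]\<close>, realised as \<^typ>\<open>rat fps\<close> with
  \<open>q = fps_X\<close>. In \<open>\<rat>[[q]]\<close> every denominator below has nonzero constant term, so that
  the division is multiplication by the inverse power series.
\<close>

definition ratq :: "rat poly fract" where
  "ratq = Fract [:0, 1:] 1"

definition q_int :: "'a::{comm_ring_1,inverse} \<Rightarrow> nat \<Rightarrow> 'a" where
  "q_int q n = (1 - q ^ n) / (1 - q)"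

definition q_poch :: "'a::{comm_ring_1,inverse} \<Rightarrow> 'a \<Rightarrow> nat \<Rightarrow> 'a" where
  "q_poch a Q m = (\<Prod>j<m. 1 - a * Q ^ j)"


section \<open>The series F\<close>

definition kappa :: "'a::{comm_ring_1,inverse} \<Rightarrow> 'a" where
  "kappa q = (1 - q)\<^sup>2 / ((1 + q) * (1 + q ^ 3))"

definition F_coeff :: "'a::{comm_ring_1,inverse} \<Rightarrow> nat \<Rightarrow> 'a" where
  "F_coeff q m = (-1) ^ m * q ^ (m * (m + 2)) *
     (q_poch (kappa q * q) (q\<^sup>2) m / q_poch (q\<^sup>2) (q\<^sup>2) m)"

text \<open>\<open>F\<close> as a formal power series in \<open>z\<close> over \<open>\<rat>(q)\<close>.\<close>

definition F_fps :: "rat poly fract fps" where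
  "F_fps = Abs_fps (F_coeff ratq)"

text \<open>The substitution \<open>G(z) \<mapsto> G(c z)\<close>.\<close>

definition dilate :: "'a::comm_ring_1 \<Rightarrow> 'a fps \<Rightarrow> 'a fps" where
  "dilate c G = fps_compose G (fps_const c * fps_X)"

definition F_equation :: "rat poly fract fps \<Rightarrow> bool" where
  "F_equation G \<longleftrightarrow>
     G = (1 - fps_const (ratq ^ 3) * fps_X) * dilate (ratq\<^sup>2) G
         + fps_const (kappa ratq * ratq ^ 4) * fps_X * dilate (ratq ^ 4) G"

text \<open>
  The value of \<open>F\<close> at \<open>z \<in> \<rat>[[q]]\<close>, with its coefficients expanded in \<open>\<rat>[[q]]\<close>; the infinite
  sum refers to the metric on \<^typ>\<open>rat fps\<close>, which induces the q-adic topology.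
\<close>

definition F_at :: "rat fps \<Rightarrow> rat fps" where
  "F_at z = (\<Sum>m. F_coeff fps_X m * z ^ m)"

definition R_q :: "rat fps" where
  "R_q = (1 + fps_X ^ 3) / (1 - fps_X) * (F_at 1 / F_at (fps_X\<^sup>2))"


section \<open>q-real numbers\<close>

text \<open>
  Finite negative continued fractions, indexed from 0: \<open>neg_cf c N\<close> is
  \<open>c 0 - 1 / (c 1 - 1 / (\<dots> - 1 / c N))\<close>, and \<open>q_neg_cf c N\<close> is its q-deformation.
\<close>

primrec neg_cf :: "(nat \<Rightarrow> nat) \<Rightarrow> nat \<Rightarrow> real" where
  "neg_cf c 0 = real (c 0)"
| "neg_cf c (Suc N) = real (c 0) - 1 / neg_cf (\<lambda>j. c (Suc j)) N"

primrec q_neg_cf :: "(nat \<Rightarrow> nat) \<Rightarrow> nat \<Rightarrow> rat fps" where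
  "q_neg_cf c 0 = q_int fps_X (c 0)"
| "q_neg_cf c (Suc N) =
     q_int fps_X (c 0) - fps_X ^ (c 0 - 1) / q_neg_cf (\<lambda>j. c (Suc j)) N"

definition neg_cf_expansion :: "real \<Rightarrow> (nat \<Rightarrow> nat) \<Rightarrow> bool" where
  "neg_cf_expansion x c \<longleftrightarrow> (\<forall>j. c j \<ge> 2) \<and> neg_cf c \<longlonglongrightarrow> x"

text \<open>
  Every real \<open>x \<ge> 1\<close> has exactly one (infinite) expansion, and its q-deformed convergents
  converge q-adically, so that \<open>q_real x\<close> is well defined for \<open>x \<ge> 1\<close>. It is regarded as an
  element of \<open>\<rat>[[q]]\<close>; its coefficients are in fact integers.
\<close>

definition has_q_real :: "real \<Rightarrow> rat fps \<Rightarrow> bool" where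
  "has_q_real x L \<longleftrightarrow> (\<exists>c. neg_cf_expansion x c \<and> q_neg_cf c \<longlonglongrightarrow> L)"

definition q_real :: "real \<Rightarrow> rat fps" where
  "q_real x = (THE L. has_q_real x L)"

end

theory Submission
  imports Defs
begin

text \<open>
  A negative continued fraction is easiest to handle in homogeneous form. If a sequence \<open>A\<close>
  satisfies \<open>A j = [c j] A (j + 1) - q ^ (c j - 1) A (j + 2)\<close>, then the quotients
  \<open>A j / A (j + 1)\<close> obey the recursion of the tails of the continued fraction with the digits \<open>c\<close>,
  so the fraction has the value \<open>A 0 / A 1\<close>: over the reals (\<open>q = 1\<close>) if \<open>A\<close> is positive and
  weakly decreasing (\<open>neg_cf_tendsto\<close>), and \<open>q\<close>-adically if every \<open>A j\<close> has constant term 1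
  (\<open>q_neg_cf_tendsto\<close>).

  The expansion of \<open>e\<close> is \<open>[[3, 4,3,2,2,2,3, 8,3,2,2,2,2,2,2,2,3, 12,3,\<dots>]]\<close>, where the block
  number \<open>k\<close> consists of \<open>4k\<close>, \<open>3\<close>, then \<open>4k - 1\<close> digits \<open>2\<close>, and \<open>3\<close>. The heart of the proof is
  an identity in an arbitrary commutative ring (\<open>tail_numerator_step\<close>): any two
  sequences with
    \<open>P k = (1 + q^3) [4k+3] Q k + q^(4k+4) P (k+1)\<close> and
    \<open>Q k = (1 + q) [4k+5] P (k+1) + q^(4k+6) Q (k+1)\<close>
  give an explicit sequence \<open>A\<close> for these digits, with
  \<open>A 0 = [3] P 0 + q^3 Q 0\<close> and \<open>A 1 = P 0 + q^2 Q 0\<close>. It is used twice.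

  For \<open>q = 1\<close>, the two recurrences are the regular continued fraction
  \<open>(e - 1) / (3 - e) = 6 + 1/(10 + 1/(14 + \<dots>))\<close>. They are solved by the integrals of
  \<open>x^n (1 - x)^n exp x / n!\<close> over \<open>[0, 1]\<close>, taken at even and odd \<open>n\<close>, the first two of which are
  \<open>e - 1\<close> and \<open>3 - e\<close>. Then \<open>A 0 / A 1 = e\<close>, which shows that the digits above are those of \<open>e\<close>.

  For the formal variable \<open>q\<close>, they are the functional equation of \<open>F\<close> at \<open>z = q^(4k)\<close> and
  \<open>z = q^(4k+2)\<close>, up to normalising factors. Here \<open>P 0 = F(1)\<close> and
  \<open>Q 0 = (1 - q) / (1 + q^3) F(q^2)\<close>, so \<open>R = P 0 / Q 0\<close>, and both formulas for \<open>[e]\<close> are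
  ways of writing \<open>A 0 / A 1\<close>.

  The functional equation itself, and the uniqueness of its solution, amount to a two-term
  recursion for the coefficients.
\<close>


section \<open>q-integers without division\<close>

text \<open>
  Unlike the quotient \<open>(1 - q ^ n) / (1 - q)\<close>, the sum makes sense at \<open>q = 1\<close>, so that the real
  continued fraction of \<open>e\<close> and its q-deformation become instances of the same identities.
\<close>

definition q_number :: "'a::comm_ring_1 \<Rightarrow> nat \<Rightarrow> 'a" where
  "q_number q n = (\<Sum>i<n. q ^ i)"

lemma q_number_0 [simp]: "q_number q 0 = 0"
  and q_number_Suc: "q_number q (Suc n) = 1 + q * q_number q n"
  by (simp_all add: q_number_def sum.lessThan_Suc_shift sum_distrib_left del: sum.lessThan_Suc)

lemma q_number_one [simp]: "q_number 1 n = of_nat n"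
  by (simp add: q_number_def)

lemma q_number_power: "q ^ n = 1 - (1 - q) * q_number q n"
  by (simp add: q_number_def one_diff_power_eq[symmetric])

lemma q_int_fps_X: "q_int (fps_X :: rat fps) n = q_number fps_X n"
proof -
  have "1 - fps_X ^ n = (1 - fps_X :: rat fps) * q_number fps_X n"
    by (simp add: q_number_power)
  then show ?thesis
    by (simp add: q_int_def)
qed


section \<open>Real negative continued fractions\<close>

lemma neg_cf_gt_1: "(\<And>j. c j \<ge> 2) \<Longrightarrow> neg_cf c N > 1"
proof (induction N arbitrary: c)
  case 0
  from "0"[of 0] show ?case by simp
next
  case (Suc N)
  have "neg_cf (\<lambda>j. c (Suc j)) N > 1" by (rule Suc.IH) (rule Suc.prems)
  then have "1 / neg_cf (\<lambda>j. c (Suc j)) N < 1" by simp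
  moreover have "real (c 0) \<ge> 2" using Suc.prems[of 0] by simp
  ultimately show ?case by (simp only: neg_cf.simps)
qed

lemma neg_cf_le:
  assumes "\<And>j. c j \<ge> 2" shows "neg_cf c N \<le> real (c 0)"
proof (cases N)
  case (Suc M)
  have "neg_cf (\<lambda>j. c (Suc j)) M > 1" by (rule neg_cf_gt_1) (rule assms)
  then have "1 / neg_cf (\<lambda>j. c (Suc j)) M > 0" by simp
  then show ?thesis by (simp add: Suc)
qed simp

text \<open>
  All convergents of the tail lie in \<open>(1, c 1]\<close>, so its limit \<open>y\<close> has \<open>1 / y\<close> in \<open>(0, 1]\<close>. Therefore
  \<open>x = c 0 - 1 / y\<close> determines first \<open>c 0\<close>, as the floor of \<open>x\<close> plus one, and then \<open>y\<close>.
\<close>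

lemma neg_cf_expansion_tail:
  assumes "neg_cf_expansion x c"
  shows "real (c 0) - 1 \<le> x" "x < real (c 0)"
    "neg_cf_expansion (1 / (real (c 0) - x)) (\<lambda>j. c (Suc j))"
proof -
  define d where "d = (\<lambda>j. c (Suc j))"
  have c: "c j \<ge> 2" "d j \<ge> 2" for j
    using assms by (auto simp: neg_cf_expansion_def d_def)
  have lim: "neg_cf c \<longlonglongrightarrow> x"
    using assms by (simp add: neg_cf_expansion_def)
  have gt: "neg_cf d N > 1" and le: "neg_cf d N \<le> real (d 0)" for N
    using neg_cf_gt_1[of d] neg_cf_le[of d] c by auto
  have "(\<lambda>N. real (c 0) - 1 / neg_cf d N) \<longlonglongrightarrow> x"
    using LIMSEQ_Suc[OF lim] by (simp add: d_def)
  from tendsto_diff[OF tendsto_const[of "real (c 0)"] this]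
  have inv: "(\<lambda>N. 1 / neg_cf d N) \<longlonglongrightarrow> real (c 0) - x" by simp
  have "1 / neg_cf d N \<le> 1" for N using gt[of N] by (simp add: divide_le_eq)
  with inv have "real (c 0) - x \<le> 1" by (intro LIMSEQ_le_const2) auto
  then show "real (c 0) - 1 \<le> x" by simp
  have "1 / real (d 0) \<le> 1 / neg_cf d N" for N
    using gt[of N] le[of N] by (intro divide_left_mono mult_pos_pos) linarith+
  with inv have "1 / real (d 0) \<le> real (c 0) - x" by (intro LIMSEQ_le_const) auto
  moreover have "1 / real (d 0) > 0" using c(2)[of 0] by simp
  ultimately show pos: "x < real (c 0)" by linarith
  have "(\<lambda>N. 1 / (1 / neg_cf d N)) \<longlonglongrightarrow> 1 / (real (c 0) - x)"
    using pos by (intro tendsto_intros inv) auto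
  then show "neg_cf_expansion (1 / (real (c 0) - x)) (\<lambda>j. c (Suc j))"
    using c(2) by (simp add: neg_cf_expansion_def d_def)
qed

lemma neg_cf_expansion_unique:
  assumes "neg_cf_expansion x c" "neg_cf_expansion x d"
  shows "c = d"
proof
  fix j show "c j = d j" using assms
  proof (induction j arbitrary: x c d)
    case 0
    from neg_cf_expansion_tail(1,2)[OF "0"(1)] neg_cf_expansion_tail(1,2)[OF "0"(2)]
    have "real (c 0) < real (d 0) + 1" "real (d 0) < real (c 0) + 1" by linarith+
    then show ?case by linarith
  next
    case (Suc j)
    from neg_cf_expansion_tail(1,2)[OF Suc.prems(1)] neg_cf_expansion_tail(1,2)[OF Suc.prems(2)]
    have "real (c 0) < real (d 0) + 1" "real (d 0) < real (c 0) + 1" by linarith+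
    then have "c 0 = d 0" by linarith
    with neg_cf_expansion_tail(3)[OF Suc.prems(1)] neg_cf_expansion_tail(3)[OF Suc.prems(2)]
    show ?case by (intro Suc.IH[of _ "\<lambda>j. c (Suc j)" "\<lambda>j. d (Suc j)"]) auto
  qed
qed

text \<open>
  The error \<open>1 / (N + 1)\<close> is the one of the slowest expansion, \<open>1 = [[2, 2, 2, \<dots>]]\<close>, whose convergents
  are \<open>1 + 1 / (N + 1)\<close>. It is inherited by induction: if a convergent \<open>n\<close> of the tail exceeds the
  true tail \<open>t \<ge> 1\<close> by at most \<open>1 / (N + 1)\<close>, then \<open>1 / t - 1 / n \<le> 1 / (N + 2)\<close>.
\<close>

lemma neg_cf_error:
  fixes A :: "nat \<Rightarrow> real"
  assumes "\<And>j. A j = real (c j) * A (Suc j) - A (Suc (Suc j))"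
    and "\<And>j. A j > 0" and "\<And>j. A (Suc j) \<le> A j"
  shows "0 \<le> neg_cf c N - A 0 / A 1 \<and> neg_cf c N - A 0 / A 1 \<le> 1 / real (N + 1)"
  using assms
proof (induction N arbitrary: A c)
  case 0
  have "real (c 0) - A 0 / A 1 = A 2 / A 1"
    using "0"(1)[of 0] "0"(2)[of 1] by (simp add: field_simps numeral_eq_Suc)
  with "0"(2)[of 1] "0"(2)[of 2] "0"(3)[of 1] show ?case by (simp add: numeral_eq_Suc)
next
  case (Suc N)
  define n where "n = neg_cf (\<lambda>j. c (Suc j)) N"
  define t where "t = A 1 / A 2"
  have t: "t \<ge> 1" using Suc.prems(2)[of 2] Suc.prems(3)[of 1] by (simp add: t_def numeral_eq_Suc)
  have "0 \<le> n - A (Suc 0) / A (Suc 1) \<and> n - A (Suc 0) / A (Suc 1) \<le> 1 / real (N + 1)"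
    unfolding n_def by (rule Suc.IH[of "\<lambda>j. A (Suc j)"]) (rule Suc.prems)+
  then have n: "t \<le> n" "n \<le> t + 1 / real (N + 1)" by (auto simp: t_def numeral_eq_Suc)
  have eq: "neg_cf c (Suc N) - A 0 / A 1 = 1 / t - 1 / n"
  proof -
    have "A 0 / A 1 = real (c 0) - A 2 / A 1"
      using Suc.prems(1)[of 0] Suc.prems(2)[of 1] by (simp add: diff_divide_distrib numeral_2_eq_2)
    then show ?thesis by (simp add: t_def n_def)
  qed
  have "1 / n \<ge> 1 / (t + 1 / real (N + 1))" using n t by (intro divide_left_mono mult_pos_pos) auto
  moreover have "1 / t - 1 / (t + 1 / real (N + 1)) \<le> 1 / real (Suc N + 1)"
  proof -
    have "1 / t - 1 / (t + 1 / real (N + 1)) = 1 / (t * (real (N + 1) * t + 1))"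
    proof -
      have "real (N + 1) * t + 1 > 0" "real (N + 1) > 0" using t by (simp_all add: add_nonneg_pos)
      moreover have "t + 1 / real (N + 1) = (real (N + 1) * t + 1) / real (N + 1)"
        using \<open>real (N + 1) > 0\<close> by (simp add: add_divide_distrib)
      ultimately show ?thesis using t by (simp add: divide_simps) (simp add: algebra_simps)
    qed
    also have "\<dots> \<le> 1 / (1 * (real (N + 1) * 1 + 1))"
      using t by (intro divide_left_mono mult_mono add_mono mult_pos_pos add_pos_pos) auto
    finally show ?thesis by simp
  qed
  moreover have "1 / n \<le> 1 / t" using n t by (intro divide_left_mono mult_pos_pos) auto
  ultimately show ?case unfolding eq by linarith
qed

lemma neg_cf_tendsto:
  fixes A :: "nat \<Rightarrow> real"
  assumes "\<And>j. A j = real (c j) * A (Suc j) - A (Suc (Suc j))"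
    and "\<And>j. A j > 0" and "\<And>j. A (Suc j) \<le> A j"
  shows "neg_cf c \<longlonglongrightarrow> A 0 / A 1"
proof -
  have "(\<lambda>N. neg_cf c N - A 0 / A 1) \<longlonglongrightarrow> 0"
  proof (rule tendsto_sandwich)
    show "\<forall>\<^sub>F N in sequentially. 0 \<le> neg_cf c N - A 0 / A 1"
      "\<forall>\<^sub>F N in sequentially. neg_cf c N - A 0 / A 1 \<le> 1 / real (N + 1)"
      using neg_cf_error[of A c, OF assms] by (blast intro: always_eventually)+
    show "(\<lambda>N. 1 / real (N + 1)) \<longlonglongrightarrow> 0"
      using LIMSEQ_inverse_real_of_nat by (simp add: divide_inverse)
    show "(\<lambda>N. 0 :: real) \<longlonglongrightarrow> 0" by simp
  qed
  then show ?thesis by (simp add: LIM_zero_iff)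
qed


section \<open>q-adic limits\<close>

lemma fps_X_power_dvd_iff: "fps_X ^ n dvd (f :: 'a::comm_ring_1 fps) \<longleftrightarrow> (\<forall>i<n. fps_nth f i = 0)"
proof
  assume *: "\<forall>i<n. fps_nth f i = 0"
  then have "f = fps_X ^ n * fps_shift n f"
    by (intro fps_ext) (auto simp: fps_X_power_mult_nth)
  then show "fps_X ^ n dvd f" by (rule dvdI)
qed (auto simp: fps_X_power_mult_nth elim!: dvdE)

lemma fps_eqI_mod:
  assumes "\<And>n. fps_X ^ n dvd (f - g :: 'a::comm_ring_1 fps)"
  shows "f = g"
  using assms unfolding fps_X_power_dvd_iff by (auto intro!: fps_ext)

text \<open>
  Limits, infinite sums and equalities of power series are all obtained from congruences modulo powers
  of \<open>q\<close>, which combine under ring operations.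
\<close>

lemma fps_tendsto_mod:
  assumes "\<And>n. fps_X ^ n dvd (f n - L :: 'a::comm_ring_1 fps)"
  shows "f \<longlonglongrightarrow> L"
proof (rule tendsto_fpsI)
  fix i
  show "\<forall>\<^sub>F n in sequentially. fps_nth (f n) i = fps_nth L i"
    using eventually_gt_at_top[of i]
    by eventually_elim (use assms in \<open>auto simp: fps_X_power_dvd_iff\<close>)
qed

lemma fps_sums_mod:
  fixes f :: "nat \<Rightarrow> 'a::comm_ring_1 fps"
  assumes "\<And>m. fps_X ^ m dvd f m"
  shows "summable f" "fps_X ^ n dvd suminf f - (\<Sum>m<n. f m)"
proof -
  define L where "L = Abs_fps (\<lambda>i. \<Sum>m\<le>i. fps_nth (f m) i)"
  have L: "fps_X ^ n dvd (\<Sum>m<n. f m) - L" for n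
    unfolding fps_X_power_dvd_iff
  proof (intro allI impI)
    fix i assume i: "i < n"
    \<comment> \<open>only the terms up to \<open>i\<close> contribute to the coefficient of \<open>q ^ i\<close>\<close>
    have "(\<Sum>m<n. fps_nth (f m) i) = (\<Sum>m\<le>i. fps_nth (f m) i)"
    proof (rule sum.mono_neutral_right)
      show "\<forall>m\<in>{..<n} - {..i}. fps_nth (f m) i = 0"
        using assms by (auto simp: fps_X_power_dvd_iff)
    qed (use i in auto)
    then show "fps_nth ((\<Sum>m<n. f m) - L) i = 0" by (simp add: L_def fps_sum_nth)
  qed
  then have "f sums L" unfolding sums_def by (rule fps_tendsto_mod)
  then have "summable f" "suminf f = L" by (simp_all add: sums_iff)
  moreover have "fps_X ^ n dvd L - (\<Sum>m<n. f m)"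
    using L[of n] by (metis dvd_minus_iff minus_diff_eq)
  ultimately show "summable f" "fps_X ^ n dvd suminf f - (\<Sum>m<n. f m)" by simp_all
qed

text \<open>
  Replacing the true tail by a convergent changes the value by
  \<open>q ^ (c 0 - 1)\<close> times the error of the convergent times a unit. As \<open>c 0 - 1 \<ge> 1\<close>, every step back
  towards the first digit gains at least one factor \<open>q\<close>.
\<close>

lemma q_neg_cf_error:
  fixes A :: "nat \<Rightarrow> rat fps"
  assumes "\<And>j. A j = q_number fps_X (c j) * A (Suc j) - fps_X ^ (c j - 1) * A (Suc (Suc j))"
    and "\<And>j. fps_nth (A j) 0 = 1" and "\<And>j. c j \<ge> 2"
  shows "fps_nth (q_neg_cf c N) 0 = 1 \<and> fps_X ^ Suc N dvd A 1 * q_neg_cf c N - A 0"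
  using assms
proof (induction N arbitrary: A c)
  case 0
  have c: "c 0 = Suc (Suc (c 0 - 2))" using "0"(3)[of 0] by simp
  have "A 1 * q_neg_cf c 0 - A 0 = fps_X ^ (c 0 - 1) * A 2"
    using "0"(1)[of 0] by (simp add: q_int_fps_X numeral_2_eq_2)
  moreover have "fps_X ^ Suc 0 dvd (fps_X ^ (c 0 - 1) :: rat fps)"
    using "0"(3)[of 0] by (intro le_imp_power_dvd) simp
  moreover have "fps_nth (q_neg_cf c 0) 0 = 1"
    by (subst q_neg_cf.simps(1), subst q_int_fps_X, subst c) (simp add: q_number_Suc)
  ultimately show ?case by (simp only: dvd_mult2 simp_thms)
next
  case (Suc N)
  define n where "n = q_neg_cf (\<lambda>j. c (Suc j)) N"
  have c: "c 0 = Suc (Suc (c 0 - 2))" using Suc.prems(3)[of 0] by simp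
  have "fps_nth n 0 = 1 \<and> fps_X ^ Suc N dvd A (Suc 1) * n - A (Suc 0)"
    unfolding n_def by (rule Suc.IH[of "\<lambda>j. A (Suc j)"]) (rule Suc.prems)+
  then have n0: "fps_nth n 0 = 1" and dvd: "fps_X ^ Suc N dvd A 2 * n - A 1"
    by (simp_all add: numeral_2_eq_2)
  have inv: "inverse n * n = 1" using n0 by (simp add: inverse_mult_eq_1)
  have q: "q_neg_cf c (Suc N) = q_number fps_X (c 0) - fps_X ^ (c 0 - 1) * inverse n"
    using n0 by (simp add: n_def q_int_fps_X fps_divide_unit)
  have rec: "A 0 = q_number fps_X (c 0) * A 1 - fps_X ^ (c 0 - 1) * A 2"
    using Suc.prems(1)[of 0] by (simp add: numeral_2_eq_2)
  have step: "inverse n * (A 2 * n - A 1) = A 2 - inverse n * A 1"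
    using inv by (simp add: right_diff_distrib mult.left_commute)
  have "A 1 * q_neg_cf c (Suc N) - A 0 = fps_X ^ (c 0 - 1) * (inverse n * (A 2 * n - A 1))"
    unfolding q step rec by (simp add: algebra_simps)
  moreover have "fps_X ^ Suc (Suc N) dvd fps_X ^ (c 0 - 1) * (inverse n * (A 2 * n - A 1))"
  proof -
    have "fps_X ^ 1 dvd (fps_X ^ (c 0 - 1) :: rat fps)"
      using Suc.prems(3)[of 0] by (intro le_imp_power_dvd) simp
    from mult_dvd_mono[OF this dvd_mult[OF dvd]] show ?thesis by simp
  qed
  moreover have "fps_nth (q_neg_cf c (Suc N)) 0 = 1"
    unfolding q by (subst (1 2) c) (simp add: q_number_Suc)
  ultimately show ?case by simp
qed

lemma q_neg_cf_tendsto: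
  fixes A :: "nat \<Rightarrow> rat fps"
  assumes "\<And>j. A j = q_number fps_X (c j) * A (Suc j) - fps_X ^ (c j - 1) * A (Suc (Suc j))"
    and "\<And>j. fps_nth (A j) 0 = 1" and "\<And>j. c j \<ge> 2"
  shows "q_neg_cf c \<longlonglongrightarrow> A 0 / A 1"
proof (rule fps_tendsto_mod)
  fix N
  have inv: "inverse (A 1) * A 1 = 1" using assms(2)[of 1] by (simp add: inverse_mult_eq_1)
  have "A 0 / A 1 = inverse (A 1) * A 0"
    using assms(2)[of 1] by (simp add: fps_divide_unit mult.commute)
  moreover have "inverse (A 1) * (A 1 * q_neg_cf c N - A 0)
      = (inverse (A 1) * A 1) * q_neg_cf c N - inverse (A 1) * A 0"
    by (simp only: right_diff_distrib mult.assoc)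
  ultimately have "q_neg_cf c N - A 0 / A 1 = inverse (A 1) * (A 1 * q_neg_cf c N - A 0)"
    using inv by (simp only: mult_1_left)
  moreover have "fps_X ^ N dvd A 1 * q_neg_cf c N - A 0"
    using q_neg_cf_error[of A c N, OF assms] by (meson dvd_trans le_imp_power_dvd lessI less_imp_le)
  ultimately show "fps_X ^ N dvd q_neg_cf c N - A 0 / A 1" by simp
qed

text \<open>
  The description by THE is meaningful because a real number has only one expansion and a sequence
  only one q-adic limit.
\<close>

lemma has_q_real_q_real:
  assumes "neg_cf_expansion x c" "q_neg_cf c \<longlonglongrightarrow> L"
  shows "has_q_real x (q_real x)" "q_real x = L"
proof -
  have L: "has_q_real x L" using assms by (auto simp: has_q_real_def)
  have "L' = L" if "has_q_real x L'" for L'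
    using that assms neg_cf_expansion_unique LIMSEQ_unique unfolding has_q_real_def by metis
  with L show "q_real x = L" unfolding q_real_def by (intro the_equality)
  with L show "has_q_real x (q_real x)" by simp
qed


section \<open>The digits of e and the homogeneous tails\<close>

text \<open>
  The digits of \<open>e\<close> are produced by an automaton. In the state \<open>(k, s)\<close> with \<open>s > 0\<close> the current digit belongs to the
  block number \<open>k\<close> and is followed by \<open>s - 1\<close> further digits of it, so \<open>s\<close> runs down from \<open>4k + 1\<close>
  (the first \<open>3\<close>) through the digits \<open>2\<close> to \<open>1\<close> (the last \<open>3\<close>). The state \<open>(k, 0)\<close> stands for the
  digit \<open>4 (k + 1)\<close> that opens the next block. Starting in \<open>(0, 1)\<close> makes the leading \<open>3\<close> of the
  expansion the last digit of a block number 0.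
\<close>

definition e_step :: "nat \<times> nat \<Rightarrow> nat \<times> nat" where
  "e_step = (\<lambda>(k, s). if s = 0 then (Suc k, 4 * k + 5) else (k, s - 1))"

definition e_digit :: "nat \<times> nat \<Rightarrow> nat" where
  "e_digit = (\<lambda>(k, s). if s = 0 then 4 * k + 4 else if s = 1 \<or> s = 4 * k + 1 then 3 else 2)"

definition e_state :: "nat \<Rightarrow> nat \<times> nat" where
  "e_state j = (e_step ^^ j) (0, 1)"

lemma e_state_0: "e_state 0 = (0, 1)" and e_state_Suc: "e_state (Suc j) = e_step (e_state j)"
  by (simp_all add: e_state_def)

lemma e_state_bound: "snd (e_state j) \<le> 4 * fst (e_state j) + 1"
  by (induction j) (auto simp: e_state_0 e_state_Suc e_step_def split: prod.split)

text \<open>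
  The terms of the homogeneous sequence, as a function of the state. The digit \<open>2\<close> stands for the
  recurrence \<open>A j = (1 + q) A (j + 1) - q A (j + 2)\<close>, whose characteristic roots are 1 and \<open>q\<close>; its
  solutions are affine in \<open>[s]\<close>, which explains the first case, the slope being fixed by the
  last digit \<open>3\<close> of the block. The state \<open>(0, 1)\<close> is a last digit, although \<open>s = 4k + 1\<close> there, and
  follows the first case.
\<close>

definition tail_numerator :: "'a::comm_ring_1 \<Rightarrow> (nat \<Rightarrow> 'a) \<Rightarrow> (nat \<Rightarrow> 'a) \<Rightarrow> nat \<times> nat \<Rightarrow> 'a" where
  "tail_numerator q P Q = (\<lambda>(k, s).
     if s \<le> 4 * k \<or> k = 0
     then P k + q\<^sup>2 * Q k + q_number q s * (q * (1 + q) * P k - q\<^sup>2 * (1 - q) * Q k)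
     else (1 + q\<^sup>2) * Q (k - 1))"

text \<open>
  Two of the four kinds of states are identities for arbitrary \<open>P\<close> and \<open>Q\<close>: inside the run of digits
  \<open>2\<close> and at the last \<open>3\<close> of a block. The opening digit \<open>4 (k + 1)\<close> needs the recurrence for \<open>P\<close>; there
  and at the first \<open>3\<close>, the recurrence for \<open>Q\<close> makes the two cases of the definition fit together.
  Everything becomes polynomial once \<open>q ^ (4k)\<close> is written as \<open>1 - (1 - q) [4k]\<close>.
\<close>

lemma tail_numerator_step:
  fixes q :: "'a::comm_ring_1"
  assumes P: "\<And>k. P k = (1 + q ^ 3) * q_number q (4 * k + 3) * Q k + q ^ (4 * k + 4) * P (Suc k)"
    and Q: "\<And>k. Q k = (1 + q) * q_number q (4 * k + 5) * P (Suc k) + q ^ (4 * k + 6) * Q (Suc k)"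
    and s: "snd t \<le> 4 * fst t + 1"
  shows "tail_numerator q P Q t = q_number q (e_digit t) * tail_numerator q P Q (e_step t)
           - q ^ (e_digit t - 1) * tail_numerator q P Q (e_step (e_step t))"
proof -
  obtain k s where t: "t = (k, s)" by (cases t)
  consider "s = 0" | "s = 1" | r where "s = r + 2" "r + 2 \<le> 4 * k"
    | i where "k = Suc i" "s = 4 * k + 1"
  proof (cases "s \<le> 1 \<or> s \<le> 4 * k")
    case True
    then show ?thesis using that(1,2) that(3)[of "s - 2"] by fastforce
  next
    case False
    then show ?thesis using s that(4)[of "k - 1"] unfolding t by (cases k) auto
  qed
  then show ?thesis
  proof cases
    case 1
    define x where "x = q_number q (4 * k)"
    have g: "q_number q (4 * k + 3) = 1 + q * (1 + q * (1 + q * x))"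
      "q_number q (4 * k + 4) = 1 + q * (1 + q * (1 + q * (1 + q * x)))"
      "q_number q (4 * k + 5) = 1 + q * (1 + q * (1 + q * (1 + q * (1 + q * x))))"
      by (simp_all add: x_def q_number_Suc numeral_eq_Suc)
    have h: "q ^ (4 * k + n) = (1 - (1 - q) * x) * q ^ n" for n
      by (simp add: power_add q_number_power[of q "4 * k"] x_def)
    have *: "tail_numerator q P Q t = P k + q\<^sup>2 * Q k"
      "tail_numerator q P Q (e_step t) = (1 + q\<^sup>2) * Q k"
      "tail_numerator q P Q (e_step (e_step t)) = P (Suc k) + q\<^sup>2 * Q (Suc k) +
         q_number q (4 * k + 4) * (q * (1 + q) * P (Suc k) - q\<^sup>2 * (1 - q) * Q (Suc k))"
      "e_digit t = 4 * k + 4" "4 * k + 4 - 1 = 4 * k + 3"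
      by (simp_all add: t 1 tail_numerator_def e_step_def e_digit_def add.commute)
    show ?thesis
      unfolding * P[of k] Q[of k] h g by (simp add: algebra_simps numeral_eq_Suc)
  next
    case 2
    then have *: "tail_numerator q P Q t = P k + q\<^sup>2 * Q k + (q * (1 + q) * P k - q\<^sup>2 * (1 - q) * Q k)"
      "tail_numerator q P Q (e_step t) = P k + q\<^sup>2 * Q k"
      "tail_numerator q P Q (e_step (e_step t)) = (1 + q\<^sup>2) * Q k"
      "e_digit t = 3"
      by (cases k; simp add: t tail_numerator_def e_step_def e_digit_def q_number_Suc)+
    show ?thesis
      unfolding * by (simp add: q_number_Suc numeral_eq_Suc algebra_simps)
  next
    case 3
    then have *: "tail_numerator q P Q t = P k + q\<^sup>2 * Q k + q_number q (Suc (Suc r)) * (q * (1 + q) * P k - q\<^sup>2 * (1 - q) * Q k)"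
      "tail_numerator q P Q (e_step t) = P k + q\<^sup>2 * Q k + q_number q (Suc r) * (q * (1 + q) * P k - q\<^sup>2 * (1 - q) * Q k)"
      "tail_numerator q P Q (e_step (e_step t)) = P k + q\<^sup>2 * Q k + q_number q r * (q * (1 + q) * P k - q\<^sup>2 * (1 - q) * Q k)"
      "e_digit t = 2"
      by (simp_all add: t tail_numerator_def e_step_def e_digit_def)
    show ?thesis
      unfolding * by (simp add: q_number_Suc numeral_eq_Suc algebra_simps)
  next
    case 4
    define x where "x = q_number q (4 * i)"
    have g: "q_number q (4 * i + 3) = 1 + q * (1 + q * (1 + q * x))"
      "q_number q (4 * i + 4) = 1 + q * (1 + q * (1 + q * (1 + q * x)))"
      "q_number q (4 * i + 5) = 1 + q * (1 + q * (1 + q * (1 + q * (1 + q * x))))"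
      "q_number q 3 = 1 + q + q\<^sup>2"
      by (simp_all add: x_def q_number_Suc numeral_eq_Suc algebra_simps)
    have h: "q ^ (4 * i + n) = (1 - (1 - q) * x) * q ^ n" for n
      by (simp add: power_add q_number_power[of q "4 * i"] x_def)
    have *: "tail_numerator q P Q t = (1 + q\<^sup>2) * Q i"
      "tail_numerator q P Q (e_step t) = P k + q\<^sup>2 * Q k + q_number q (4 * i + 4) * (q * (1 + q) * P k - q\<^sup>2 * (1 - q) * Q k)"
      "tail_numerator q P Q (e_step (e_step t)) = P k + q\<^sup>2 * Q k + q_number q (4 * i + 3) * (q * (1 + q) * P k - q\<^sup>2 * (1 - q) * Q k)"
      "e_digit t = 3"
      by (simp_all add: t 4 tail_numerator_def e_step_def e_digit_def add.commute)
    show ?thesis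
      unfolding * Q[of i] h g 4(1) by (simp add: algebra_simps numeral_eq_Suc)
  qed
qed


section \<open>The expansion of e\<close>

text \<open>
  Expanding \<open>exp x\<close> in the integral of \<open>x^i (1 - x)^j exp x / j!\<close> over \<open>[0, 1]\<close> gives the sum of these terms,
  by the beta integral. With \<open>i = j = n\<close>, the sums are the remainders of \<open>e\<close> in the introduction.
  Working with the series makes positivity evident and avoids integration.
\<close>

definition beta_term :: "nat \<Rightarrow> nat \<Rightarrow> nat \<Rightarrow> real" where
  "beta_term i j m = fact (i + m) / (fact m * fact (i + j + m + 1))"

lemma beta_term_eq: "p = i + m \<Longrightarrow> r = i + j + m + 1 \<Longrightarrow> beta_term i j m = fact p / (fact m * fact r)"
  by (simp only: beta_term_def)

lemma beta_term_pos: "beta_term i j m > 0"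
  by (simp add: beta_term_def)

lemma beta_term_le: "beta_term i j m \<le> 1 / fact m"
proof -
  have "(fact (i + m) :: real) \<le> fact (i + j + m + 1)" by (rule fact_mono) simp
  then have "fact (i + m) / fact (i + j + m + 1) \<le> (1 :: real)"
    by (simp only: divide_le_eq_1_pos fact_gt_zero)
  then have "fact (i + m) / fact (i + j + m + 1) / fact m \<le> (1 :: real) / fact m"
    by (rule divide_right_mono) simp
  then show ?thesis by (simp only: beta_term_def divide_divide_eq_left mult.commute)
qed

lemma summable_inverse_fact: "summable (\<lambda>m. 1 / fact m :: real)"
  using summable_exp[of "1::real"] by (simp add: divide_inverse)

lemma summable_beta_term: "summable (beta_term i j)"
  by (rule summable_comparison_test'[OF summable_inverse_fact, of 0])
     (simp add: beta_term_le beta_term_pos less_imp_le)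

definition e_remainder :: "nat \<Rightarrow> real" where
  "e_remainder n = (\<Sum>m. beta_term n n m)"

lemma e_remainder_pos: "e_remainder n > 0"
  unfolding e_remainder_def by (rule suminf_pos[OF summable_beta_term]) (rule beta_term_pos)

text \<open>
  In terms of integrals, put \<open>w = x (1 - x)\<close>. Then
  \<open>(w^n / n! - (4n + 6) w^(n+1) / (n+1)! - w^(n+2) / (n+2)!) exp x\<close> is the derivative of
  \<open>(w^(n+1) (1 - 2x) - w^(n+2) / (n+2)) exp x / (n+1)!\<close>, which vanishes at 0 and at 1. For the series this
  means that the terms telescope, and \<open>H\<close> is the antiderivative integrated term by term.
\<close>

lemma e_remainder_rec: "e_remainder n = real (4 * n + 6) * e_remainder (n + 1) + e_remainder (n + 2)"
proof -
  define f where "f m = beta_term n n m - real (4 * n + 6) * beta_term (n + 1) (n + 1) m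
    - beta_term (n + 2) (n + 2) m" for m
  define H where "H m = beta_term (n + 1) (n + 1) m - 2 * beta_term (n + 2) (n + 1) m
    - beta_term (n + 2) (n + 2) m" for m
  have part: "(\<Sum>m<Suc M. f m) = H M" for M
  proof (induction M)
    case 0
    show ?case
      by (simp add: f_def H_def beta_term_def numeral_eq_Suc divide_simps) (simp add: algebra_simps)
  next
    case (Suc M)
    define u where "u = (fact (n + M) :: real)"
    define v where "v = (fact (2 * n + M + 2) :: real)"
    define w where "w = (fact M :: real)"
    have pos: "u > 0" "v > 0" "w > 0" by (simp_all add: u_def v_def w_def)
    define N where "N = 2 * real n + real M"
    have facts: "fact (n + M) = u" "fact M = w" "fact (2 * n + M + 2) = v"
      by (simp_all add: u_def v_def w_def)
    have rising: "fact (a + 1) = (real a + 1) * fact a"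
      "fact (a + 2) = (real a + 2) * ((real a + 1) * fact a)"
      "fact (a + 3) = (real a + 3) * ((real a + 2) * ((real a + 1) * fact a))"
      "fact (a + 4) = (real a + 4) * ((real a + 3) * ((real a + 2) * ((real a + 1) * fact a)))"
      for a :: nat
      by (simp_all add: numeral_eq_Suc algebra_simps)
    have upper: "fact (n + M + 1) = (real n + real M + 1) * u"
      "fact (n + M + 2) = (real n + real M + 2) * ((real n + real M + 1) * u)"
      "fact (n + M + 3) = (real n + real M + 3) * ((real n + real M + 2) * ((real n + real M + 1) * u))"
      "fact (M + 1) = (real M + 1) * w"
      unfolding rising facts by simp_all
    have lower: "fact (2 * n + M + 3) = (N + 3) * v"
      "fact (2 * n + M + 4) = (N + 4) * ((N + 3) * v)"
      "fact (2 * n + M + 5) = (N + 5) * ((N + 4) * ((N + 3) * v))"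
      "fact (2 * n + M + 6) = (N + 6) * ((N + 5) * ((N + 4) * ((N + 3) * v)))"
    proof -
      define a where "a = 2 * n + M + 2"
      have shift: "2 * n + M + 3 = a + 1" "2 * n + M + 4 = a + 2" "2 * n + M + 5 = a + 3"
        "2 * n + M + 6 = a + 4"
        by (simp_all add: a_def)
      have a: "fact a = v" "real a = N + 2" by (simp_all add: a_def v_def N_def)
      show "fact (2 * n + M + 3) = (N + 3) * v"
        "fact (2 * n + M + 4) = (N + 4) * ((N + 3) * v)"
        "fact (2 * n + M + 5) = (N + 5) * ((N + 4) * ((N + 3) * v))"
        "fact (2 * n + M + 6) = (N + 6) * ((N + 5) * ((N + 4) * ((N + 3) * v)))"
        unfolding shift rising a by (simp_all add: add.assoc)
    qed
    \<comment> \<open>a common divisor of the seven terms, which leaves a polynomial identity\<close>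
    define K where "K = (real n + real M + 1) * u /
      ((real M + 1) * w * ((N + 6) * ((N + 5) * ((N + 4) * ((N + 3) * v)))))"
    have nz: "N + 3 \<noteq> 0" "N + 4 \<noteq> 0" "N + 5 \<noteq> 0" "N + 6 \<noteq> 0" "real M + 1 \<noteq> 0"
      "v \<noteq> 0" "w \<noteq> 0"
      using pos by (simp_all add: N_def add_nonneg_eq_0_iff)
    have "beta_term n n (M + 1) = fact (n + M + 1) / (fact (M + 1) * fact (2 * n + M + 2))"
      by (rule beta_term_eq) simp_all
    then have b1: "beta_term n n (M + 1) = (N + 3) * (N + 4) * (N + 5) * (N + 6) * K"
      unfolding upper lower facts K_def using nz by simp
    have "beta_term (n + 1) (n + 1) (M + 1) = fact (n + M + 2) / (fact (M + 1) * fact (2 * n + M + 4))"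
      by (rule beta_term_eq) simp_all
    then have b2: "beta_term (n + 1) (n + 1) (M + 1) = (real n + real M + 2) * (N + 5) * (N + 6) * K"
      unfolding upper lower facts K_def using nz by simp
    have "beta_term (n + 2) (n + 1) (M + 1) = fact (n + M + 3) / (fact (M + 1) * fact (2 * n + M + 5))"
      by (rule beta_term_eq) simp_all
    then have b3: "beta_term (n + 2) (n + 1) (M + 1) =
        (real n + real M + 3) * (real n + real M + 2) * (N + 6) * K"
      unfolding upper lower facts K_def using nz by simp
    have "beta_term (n + 2) (n + 2) (M + 1) = fact (n + M + 3) / (fact (M + 1) * fact (2 * n + M + 6))"
      by (rule beta_term_eq) simp_all
    then have b4: "beta_term (n + 2) (n + 2) (M + 1) =
        (real n + real M + 3) * (real n + real M + 2) * K"
      unfolding upper lower facts K_def using nz by simp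
    have "beta_term (n + 1) (n + 1) M = fact (n + M + 1) / (fact M * fact (2 * n + M + 3))"
      by (rule beta_term_eq) simp_all
    then have b5: "beta_term (n + 1) (n + 1) M = (real M + 1) * (N + 4) * (N + 5) * (N + 6) * K"
      unfolding upper lower facts K_def using nz by simp
    have "beta_term (n + 2) (n + 1) M = fact (n + M + 2) / (fact M * fact (2 * n + M + 4))"
      by (rule beta_term_eq) simp_all
    then have b6: "beta_term (n + 2) (n + 1) M =
        (real M + 1) * (real n + real M + 2) * (N + 5) * (N + 6) * K"
      unfolding upper lower facts K_def using nz by simp
    have "beta_term (n + 2) (n + 2) M = fact (n + M + 2) / (fact M * fact (2 * n + M + 5))"
      by (rule beta_term_eq) simp_all
    then have b7: "beta_term (n + 2) (n + 2) M =
        (real M + 1) * (real n + real M + 2) * (N + 6) * K"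
      unfolding upper lower facts K_def using nz by simp
    have "f (M + 1) = H (M + 1) - H M"
      unfolding f_def H_def b1 b2 b3 b4 b5 b6 b7 by (simp add: N_def) algebra
    with Suc show ?case by simp
  qed
  have "f sums 0"
  proof -
    have "H \<longlonglongrightarrow> 1 * 0 - 2 * 0 - 0"
      unfolding H_def
      by (auto intro!: tendsto_eq_intros summable_LIMSEQ_zero[OF summable_beta_term])
    then have "(\<lambda>M. \<Sum>m<Suc M. f m) \<longlonglongrightarrow> 0" unfolding part by simp
    then show ?thesis unfolding sums_def by (rule LIMSEQ_imp_Suc)
  qed
  moreover have "f sums (e_remainder n - real (4 * n + 6) * e_remainder (n + 1) - e_remainder (n + 2))"
    unfolding f_def e_remainder_def
    by (intro sums_diff sums_mult summable_sums summable_beta_term)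
  ultimately show ?thesis using sums_unique2 by fastforce
qed

lemma sums_inverse_fact_shift:
  "(\<lambda>m. 1 / fact (m + k)) sums (exp 1 - (\<Sum>i<k. 1 / fact i) :: real)"
proof -
  have "(\<lambda>m. 1 / fact m) sums (exp 1 :: real)"
    using exp_converges[of "1::real"] by (simp add: divide_inverse)
  then show ?thesis by (rule sums_split_initial_segment)
qed

lemma e_remainder_0: "e_remainder 0 = exp 1 - 1"
proof -
  have "beta_term 0 0 m = 1 / fact (m + 1)" for m by (simp add: beta_term_def)
  then have "beta_term 0 0 = (\<lambda>m. 1 / fact (m + 1))" by (rule ext)
  then have "beta_term 0 0 sums (exp 1 - 1)" using sums_inverse_fact_shift[of 1] by simp
  then show ?thesis by (simp add: e_remainder_def sums_iff)
qed

lemma e_remainder_1: "e_remainder 1 = 3 - exp 1"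
proof -
  have "beta_term 1 1 m = 1 / fact (m + 2) - 2 * (1 / fact (m + 3))" for m
    by (simp add: beta_term_def numeral_eq_Suc divide_simps add_nonneg_eq_0_iff)
       (simp add: algebra_simps)?
  moreover have "(\<lambda>m. 1 / fact (m + 2) - 2 * (1 / fact (m + 3))) sums
      ((exp 1 - (\<Sum>i<2. 1 / fact i)) - 2 * (exp 1 - (\<Sum>i<3. 1 / fact i)) :: real)"
    by (intro sums_diff sums_mult sums_inverse_fact_shift)
  moreover have "(exp 1 - (\<Sum>i<2. 1 / fact i)) - 2 * (exp 1 - (\<Sum>i<3. 1 / fact i)) = 3 - exp (1 :: real)"
    by (simp add: numeral_eq_Suc)
  moreover have "beta_term 1 1 = (\<lambda>m. 1 / fact (m + 2) - 2 * (1 / fact (m + 3)))"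
    using calculation(1) by (rule ext)
  ultimately have "beta_term 1 1 sums (3 - exp 1)" by (simp only:)
  then show ?thesis by (simp add: e_remainder_def sums_iff)
qed

lemma e_digit_ge: "e_digit t \<ge> 2"
  by (auto simp: e_digit_def split: prod.split)

text \<open>
  The values \<open>P 0 = e - 1\<close> and \<open>Q 0 = 3 - e\<close> give \<open>A 0 = 3 P 0 + Q 0 = 2 e\<close> and \<open>A 1 = P 0 + Q 0 = 2\<close>.
\<close>

lemma neg_cf_expansion_exp_1: "neg_cf_expansion (exp 1) (\<lambda>j. e_digit (e_state j))"
proof -
  define P Q where "P k = e_remainder (2 * k)" and "Q k = e_remainder (2 * k + 1)" for k
  define A where "A j = tail_numerator 1 P Q (e_state j)" for j
  have P: "P k = real (8 * k + 6) * Q k + P (Suc k)" for k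
    using e_remainder_rec[of "2 * k"] by (simp add: P_def Q_def)
  have Q: "Q k = real (8 * k + 10) * P (Suc k) + Q (Suc k)" for k
    using e_remainder_rec[of "2 * k + 1"] by (simp add: P_def Q_def numeral_eq_Suc)
  have pos: "P k > 0" "Q k > 0" for k by (simp_all add: P_def Q_def e_remainder_pos)
  have PQ: "Q k < P k" for k
  proof -
    have "1 * Q k \<le> real (8 * k + 6) * Q k" using pos(2)[of k] by (intro mult_right_mono) auto
    with P[of k] pos(1)[of "Suc k"] show ?thesis by linarith
  qed
  have rec: "tail_numerator 1 P Q t = real (e_digit t) * tail_numerator 1 P Q (e_step t)
      - tail_numerator 1 P Q (e_step (e_step t))" if "snd t \<le> 4 * fst t + 1" for t
  proof -
    have P': "P k = (1 + 1 ^ 3) * q_number 1 (4 * k + 3) * Q k + 1 ^ (4 * k + 4) * P (Suc k)" for k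
      using P[of k] by (simp add: algebra_simps)
    have Q': "Q k = (1 + 1) * q_number 1 (4 * k + 5) * P (Suc k) + 1 ^ (4 * k + 6) * Q (Suc k)" for k
      using Q[of k] by (simp add: algebra_simps)
    show ?thesis using tail_numerator_step[of P 1 Q, OF P' Q' that] by simp
  qed
  have A_rec: "A j = real (e_digit (e_state j)) * A (Suc j) - A (Suc (Suc j))" for j
    unfolding A_def e_state_Suc by (rule rec) (rule e_state_bound)
  have A_pos: "A j > 0" for j
    using pos by (auto simp: A_def tail_numerator_def less_imp_le split: prod.split
        intro!: add_pos_nonneg add_nonneg_nonneg mult_nonneg_nonneg)
  have A_mono: "A (Suc j) \<le> A j" for j
  proof -
    obtain k s where t: "e_state j = (k, s)" by (cases "e_state j")
    have "s \<le> 4 * k + 1" using e_state_bound[of j] by (simp add: t)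
    then consider "s = 0" | "s > 0" "s \<le> 4 * k \<or> k = 0" | i where "k = Suc i" "s = 4 * k + 1"
      by (cases k) force+
    then show ?thesis
    proof cases
      case 1
      then show ?thesis using PQ[of k] by (simp add: A_def e_state_Suc t e_step_def tail_numerator_def)
    next
      case 2
      moreover have "real (s - 1) * (2 * P k) \<le> real s * (2 * P k)"
        using pos(1)[of k] by (intro mult_right_mono) auto
      moreover have "s - 1 \<le> 4 * k \<or> k = 0" using 2 by auto
      ultimately show ?thesis
        by (simp add: A_def e_state_Suc t e_step_def tail_numerator_def)
    next
      case 3
      have "A (Suc j) = Q i - P k"
        using Q[of i] unfolding 3 by (simp add: A_def e_state_Suc t 3 e_step_def tail_numerator_def algebra_simps)
      moreover have "A j = 2 * Q i" by (simp add: A_def t 3 tail_numerator_def)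
      ultimately show ?thesis using pos(2)[of i] pos(1)[of k] by linarith
    qed
  qed
  have "neg_cf (\<lambda>j. e_digit (e_state j)) \<longlonglongrightarrow> A 0 / A 1"
    by (rule neg_cf_tendsto[of A "\<lambda>j. e_digit (e_state j)", OF A_rec A_pos A_mono])
  moreover have "A 0 = 2 * exp 1" "A 1 = 2"
    using e_remainder_0 e_remainder_1
    by (simp_all add: A_def e_state_def e_step_def tail_numerator_def P_def Q_def)
  ultimately show ?thesis by (simp add: neg_cf_expansion_def e_digit_ge)
qed


section \<open>The functional equation of F\<close>

lemma q_poch_0 [simp]: "q_poch a Q 0 = 1"
  and q_poch_Suc: "q_poch a Q (Suc m) = q_poch a Q m * (1 - a * Q ^ m)"
  by (simp_all add: q_poch_def)

lemma F_coeff_0: "(1 :: 'a::{comm_ring_1,inverse}) / 1 = 1 \<Longrightarrow> F_coeff (q :: 'a) 0 = 1"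
  by (simp add: F_coeff_def)

text \<open>
  The assumption on division holds in \<open>\<rat>(q)\<close>, because \<open>q\<close> is not a root of unity, and in \<open>\<rat>[[q]]\<close>,
  because the q-Pochhammer symbols are units.
\<close>

lemma F_coeff_Suc:
  fixes q :: "'a::{idom,inverse}"
  assumes div: "\<And>m x. x / q_poch (q\<^sup>2) (q\<^sup>2) m * q_poch (q\<^sup>2) (q\<^sup>2) m = x"
  shows "(1 - q ^ (2 * m + 2)) * F_coeff q (Suc m)
    = - (q ^ (2 * m + 3)) * (1 - kappa q * q ^ (2 * m + 1)) * F_coeff q m"
proof -
  define d where "d = q_poch (q\<^sup>2) (q\<^sup>2)"
  define p where "p = q_poch (kappa q * q) (q\<^sup>2)"
  have F: "F_coeff q m * d m = (-1) ^ m * q ^ (m * (m + 2)) * p m" for m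
    using div[of "p m" m] by (simp add: F_coeff_def d_def p_def mult.assoc)
  have "d m \<noteq> 0" using div[of 1 m] by (auto simp: d_def)
  have d: "d (Suc m) = (1 - q ^ (2 * m + 2)) * d m"
    and p: "p (Suc m) = (1 - kappa q * q ^ (2 * m + 1)) * p m"
    by (simp_all add: d_def p_def q_poch_Suc mult.assoc mult.commute flip: power_mult power_add power_Suc)
  have "Suc m * (Suc m + 2) = (2 * m + 3) + m * (m + 2)" by simp
  then have q: "q ^ (Suc m * (Suc m + 2)) = q ^ (2 * m + 3) * q ^ (m * (m + 2))"
    by (simp only: power_add)
  have "(1 - q ^ (2 * m + 2)) * F_coeff q (Suc m) * d m = F_coeff q (Suc m) * d (Suc m)"
    unfolding d by (simp only: mult_ac)
  also have "\<dots> = - (q ^ (2 * m + 3)) * (1 - kappa q * q ^ (2 * m + 1)) * (F_coeff q m * d m)"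
    unfolding F p q by (simp add: mult_ac)
  finally have "(1 - q ^ (2 * m + 2)) * F_coeff q (Suc m) * d m
      = - (q ^ (2 * m + 3)) * (1 - kappa q * q ^ (2 * m + 1)) * F_coeff q m * d m"
    by (simp only: mult.assoc)
  then show ?thesis unfolding mult_right_cancel[OF \<open>d m \<noteq> 0\<close>] .
qed

lemma ratq_power_neq_1:
  assumes "n > 0" shows "ratq ^ n \<noteq> 1"
proof
  have power: "ratq ^ n = Fract ([:0, 1:] ^ n) 1"
    by (induction n) (simp_all add: ratq_def One_fract_def)
  assume "ratq ^ n = 1"
  then have "([:0, 1:] :: rat poly) ^ n = 1" unfolding power by (simp add: One_fract_def eq_fract)
  then have "degree (([:0, 1:] :: rat poly) ^ n) = 0" by simp
  with assms show False by (simp add: degree_power_eq)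
qed

text \<open>
  Comparing the coefficients of \<open>z ^ (n + 1)\<close> turns the functional equation into a recursion that
  determines each coefficient from the previous one.
\<close>

lemma F_equation_iff:
  "F_equation G \<longleftrightarrow> (\<forall>n. (1 - ratq ^ (2 * n + 2)) * fps_nth G (Suc n)
     = - (ratq ^ (2 * n + 3)) * (1 - kappa ratq * ratq ^ (2 * n + 1)) * fps_nth G n)"
proof -
  define H where "H = (1 - fps_const (ratq ^ 3) * fps_X) * dilate (ratq\<^sup>2) G
         + fps_const (kappa ratq * ratq ^ 4) * fps_X * dilate (ratq ^ 4) G"
  have dil: "fps_nth (dilate c G) n = c ^ n * fps_nth G n" for c :: "rat poly fract" and n
    by (simp add: dilate_def fps_compose_linear)
  have H0: "fps_nth H 0 = fps_nth G 0" by (simp add: H_def dil)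
  have HS: "fps_nth H (Suc n) = (ratq\<^sup>2) ^ Suc n * fps_nth G (Suc n) - ratq ^ 3 * ((ratq\<^sup>2) ^ n * fps_nth G n)
      + kappa ratq * ratq ^ 4 * ((ratq ^ 4) ^ n * fps_nth G n)" for n
    by (simp add: H_def dil algebra_simps)
  have "F_equation G \<longleftrightarrow> (\<forall>n. fps_nth G n = fps_nth H n)"
    by (simp add: F_equation_def H_def fps_eq_iff)
  also have "\<dots> \<longleftrightarrow> (\<forall>n. fps_nth G (Suc n) = fps_nth H (Suc n))"
    using H0 by (metis not0_implies_Suc)
  also have "\<dots> \<longleftrightarrow> (\<forall>n. (1 - ratq ^ (2 * n + 2)) * fps_nth G (Suc n)
     = - (ratq ^ (2 * n + 3)) * (1 - kappa ratq * ratq ^ (2 * n + 1)) * fps_nth G n)"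
  proof (intro all_cong1)
    fix n
    define y where "y = ratq ^ n"
    have y: "ratq ^ (2 * n + m) = y\<^sup>2 * ratq ^ m" "(ratq\<^sup>2) ^ n = y\<^sup>2" "(ratq ^ 4) ^ n = y ^ 4" for m
      by (simp_all add: y_def power_add flip: power_mult) (simp_all add: mult.commute)
    show "(fps_nth G (Suc n) = fps_nth H (Suc n)) \<longleftrightarrow> ((1 - ratq ^ (2 * n + 2)) * fps_nth G (Suc n)
     = - (ratq ^ (2 * n + 3)) * (1 - kappa ratq * ratq ^ (2 * n + 1)) * fps_nth G n)"
      unfolding HS y power_Suc by algebra
  qed
  finally show ?thesis .
qed

lemma F_fps_characterization: "fps_nth G 0 = 1 \<and> F_equation G \<longleftrightarrow> G = F_fps"
proof -
  have ne: "1 - ratq ^ (2 * m + 2) \<noteq> 0" for m using ratq_power_neq_1[of "2 * m + 2"] by simp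
  have "q_poch (ratq\<^sup>2) (ratq\<^sup>2) m \<noteq> 0" for m
  proof (induction m)
    case (Suc m)
    have "ratq\<^sup>2 * (ratq\<^sup>2) ^ m = ratq ^ (2 * m + 2)" by (simp add: add.commute flip: power_mult power_add)
    with Suc ne[of m] show ?case by (simp add: q_poch_Suc)
  qed simp
  then have F: "(1 - ratq ^ (2 * n + 2)) * fps_nth F_fps (Suc n)
     = - (ratq ^ (2 * n + 3)) * (1 - kappa ratq * ratq ^ (2 * n + 1)) * fps_nth F_fps n" for n
    unfolding F_fps_def fps_nth_Abs_fps by (intro F_coeff_Suc) simp
  have F0: "fps_nth F_fps 0 = 1" by (simp add: F_fps_def F_coeff_0)
  have "G = F_fps" if G: "fps_nth G 0 = 1" "F_equation G"
  proof (rule fps_ext)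
    fix n show "fps_nth G n = fps_nth F_fps n"
    proof (induction n)
      case 0 show ?case by (simp add: G F0)
    next
      case (Suc n)
      have "(1 - ratq ^ (2 * n + 2)) * fps_nth G (Suc n) = (1 - ratq ^ (2 * n + 2)) * fps_nth F_fps (Suc n)"
        using G(2) F[of n] Suc unfolding F_equation_iff by simp
      with ne[of n] show ?case by simp
    qed
  qed
  moreover have "F_equation F_fps" unfolding F_equation_iff using F by blast
  ultimately show ?thesis using F0 by blast
qed

lemma F_coeff_fps_Suc:
  "(1 - fps_X ^ (2 * m + 2)) * F_coeff (fps_X :: rat fps) (Suc m)
    = - (fps_X ^ (2 * m + 3)) * (1 - kappa fps_X * fps_X ^ (2 * m + 1)) * F_coeff fps_X m"
proof (rule F_coeff_Suc)
  fix m and x :: "rat fps"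
  have "fps_nth (q_poch (fps_X\<^sup>2 :: rat fps) (fps_X\<^sup>2) m) 0 = 1"
    by (induction m) (simp_all add: q_poch_Suc)
  then show "x / q_poch (fps_X\<^sup>2) (fps_X\<^sup>2) m * q_poch (fps_X\<^sup>2) (fps_X\<^sup>2) m = x"
    by simp
qed

lemma F_coeff_fps_dvd: "fps_X ^ m dvd F_coeff (fps_X :: rat fps) m * z ^ m"
proof -
  have "fps_X ^ m dvd (fps_X ^ (m * (m + 2)) :: rat fps)" by (intro le_imp_power_dvd) simp
  then show ?thesis unfolding F_coeff_def by (intro dvd_mult2 dvd_mult)
qed

lemma summable_F_at: "summable (\<lambda>m. F_coeff (fps_X :: rat fps) m * z ^ m)"
  and F_at_mod: "fps_X ^ n dvd F_at z - (\<Sum>m<n. F_coeff fps_X m * z ^ m)"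
  unfolding F_at_def by (rule fps_sums_mod[OF F_coeff_fps_dvd])+

lemma F_at_nth_0: "fps_nth (F_at z) 0 = 1"
  using F_at_mod[of 1 z] unfolding fps_X_power_dvd_iff by (simp add: F_coeff_0)

text \<open>
  The recursion of the coefficients gives the equation for partial sums \<open>S n\<close> without any error term if
  one summand less is taken in the terms carrying a factor \<open>z\<close>. Hence the equation for \<open>F\<close> holds modulo
  every power of \<open>q\<close>.
\<close>

lemma F_at_equation:
  "F_at z = (1 - fps_X ^ 3 * z) * F_at (fps_X\<^sup>2 * z) + kappa fps_X * fps_X ^ 4 * z * F_at (fps_X ^ 4 * z)"
proof (rule fps_eqI_mod)
  fix N
  define S where "S n z = (\<Sum>m<n. F_coeff (fps_X :: rat fps) m * z ^ m)" for n z
  have mod: "fps_X ^ n dvd F_at y - S n y" for n y unfolding S_def by (rule F_at_mod)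
  have S: "S (Suc n) z = S (Suc n) (fps_X\<^sup>2 * z) - fps_X ^ 3 * z * S n (fps_X\<^sup>2 * z)
      + kappa fps_X * fps_X ^ 4 * z * S n (fps_X ^ 4 * z)" for n
  proof (induction n)
    case 0
    show ?case by (simp add: S_def)
  next
    case (Suc n)
    have S_Suc: "S (Suc k) y = S k y + F_coeff fps_X k * y ^ k" for k y by (simp add: S_def)
    define x where "x = (fps_X :: rat fps) ^ (2 * n)"
    have x: "fps_X ^ (2 * n + i) = x * fps_X ^ i" for i by (simp add: x_def power_add)
    have y: "(fps_X\<^sup>2 * z) ^ n = x * z ^ n" "(fps_X ^ 4 * z) ^ n = x * x * z ^ n"
      "(fps_X\<^sup>2 * z) ^ Suc n = fps_X ^ (2 * n + 2) * z ^ Suc n"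
      by (simp_all add: x_def power_mult_distrib add.commute flip: power_mult power_add power_Suc)
    have "S (Suc (Suc n)) z - S (Suc (Suc n)) (fps_X\<^sup>2 * z) = S (Suc n) z - S (Suc n) (fps_X\<^sup>2 * z)
        + (1 - fps_X ^ (2 * n + 2)) * F_coeff fps_X (Suc n) * z ^ Suc n"
      unfolding S_Suc[of "Suc n"] y by (simp only: algebra_simps mult_1_left)
    also have "\<dots> = - (fps_X ^ 3 * z * S n (fps_X\<^sup>2 * z))
      + kappa fps_X * fps_X ^ 4 * z * S n (fps_X ^ 4 * z)
      - (fps_X ^ (2 * n + 3)) * (1 - kappa fps_X * fps_X ^ (2 * n + 1)) * F_coeff fps_X n * z ^ Suc n"
      unfolding F_coeff_fps_Suc Suc by (simp add: algebra_simps)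
    also have "\<dots> = - (fps_X ^ 3 * z * S (Suc n) (fps_X\<^sup>2 * z))
      + kappa fps_X * fps_X ^ 4 * z * S (Suc n) (fps_X ^ 4 * z)"
      unfolding S_Suc[of n] y x by (simp add: numeral_eq_Suc algebra_simps)
    finally show ?case by (simp add: algebra_simps)
  qed
  have "F_at z - ((1 - fps_X ^ 3 * z) * F_at (fps_X\<^sup>2 * z) + kappa fps_X * fps_X ^ 4 * z * F_at (fps_X ^ 4 * z))
    = (F_at z - S (Suc N) z) - (F_at (fps_X\<^sup>2 * z) - S (Suc N) (fps_X\<^sup>2 * z))
      + fps_X ^ 3 * z * (F_at (fps_X\<^sup>2 * z) - S N (fps_X\<^sup>2 * z))
      - kappa fps_X * fps_X ^ 4 * z * (F_at (fps_X ^ 4 * z) - S N (fps_X ^ 4 * z))"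
    using S[of N] by algebra
  also have "fps_X ^ N dvd \<dots>"
  proof -
    have mod_Suc: "fps_X ^ N dvd F_at y - S (Suc N) y" for y
      by (rule dvd_trans[OF le_imp_power_dvd mod]) simp
    show ?thesis
      by (rule mod mod_Suc | rule dvd_add dvd_diff dvd_mult)+
  qed
  finally show "fps_X ^ N dvd F_at z - ((1 - fps_X ^ 3 * z) * F_at (fps_X\<^sup>2 * z) + kappa fps_X * fps_X ^ 4 * z * F_at (fps_X ^ 4 * z))" .
qed


section \<open>The q-deformation of e\<close>

lemma kappa_fps: "(1 + fps_X) * (1 + fps_X ^ 3) * kappa (fps_X :: rat fps) = (1 - fps_X)\<^sup>2"
proof -
  have "fps_nth ((1 + fps_X) * (1 + fps_X ^ 3) :: rat fps) 0 \<noteq> 0" by simp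
  then have "(1 + fps_X) * (1 + fps_X ^ 3) dvd ((1 - fps_X)\<^sup>2 :: rat fps)" by (rule fps_unit_dvd)
  then show ?thesis unfolding kappa_def by (rule dvd_mult_div_cancel)
qed

text \<open>
  The values of \<open>F\<close> at the even powers of \<open>q\<close>, rescaled such that the functional equation becomes the
  pair of recurrences required of \<open>P\<close> and \<open>Q\<close>. The step from \<open>P k\<close> to \<open>P (k + 1)\<close> absorbs the factor
  \<open>\<kappa>\<close> of the functional equation, and the step from \<open>P k\<close> to \<open>Q k\<close> turns \<open>1 - q ^ (4k + 3)\<close> into
  \<open>(1 + q^3) [4k + 3]\<close>.
\<close>

definition F_even :: "nat \<Rightarrow> rat fps" where
  "F_even k = kappa fps_X ^ k * F_at (fps_X ^ (4 * k))"

definition F_odd :: "nat \<Rightarrow> rat fps" where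
  "F_odd k = kappa fps_X ^ k * ((1 - fps_X) / (1 + fps_X ^ 3)) * F_at (fps_X ^ (4 * k + 2))"

lemma F_even_rec:
  "F_even k = (1 + fps_X ^ 3) * q_number fps_X (4 * k + 3) * F_odd k + fps_X ^ (4 * k + 4) * F_even (Suc k)"
  and F_odd_rec:
  "F_odd k = (1 + fps_X) * q_number fps_X (4 * k + 5) * F_even (Suc k) + fps_X ^ (4 * k + 6) * F_odd (Suc k)"
proof -
  define X :: "rat fps" where "X = fps_X"
  define r where "r = (1 - X) / (1 + X ^ 3)"
  have r: "(1 + X ^ 3) * r = 1 - X"
    unfolding r_def X_def by (rule dvd_mult_div_cancel) (rule fps_unit_dvd, simp)
  \<comment> \<open>both sides are \<open>(1 - q)^2\<close>, by the definition of \<open>\<kappa>\<close>\<close>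
  have "(1 + X ^ 3) * ((1 - X) * r) = (1 + X ^ 3) * ((1 + X) * kappa X)"
    using r kappa_fps by (simp add: X_def power2_eq_square mult_ac)
  moreover have "1 + X ^ 3 \<noteq> 0" unfolding X_def by (metis fps_nonzeroI fps_add_nth fps_one_nth fps_X_power_nth add_0_right one_neq_zero zero_neq_numeral)
  ultimately have k: "(1 - X) * r = (1 + X) * kappa X" by simp
  have q_number: "(1 - X) * q_number X n = 1 - X ^ n" for n using q_number_power[of X n] by simp
  define F0 where "F0 = F_at (X ^ (4 * k))"
  define F2 where "F2 = F_at (X ^ (4 * k + 2))"
  define F4 where "F4 = F_at (X ^ (4 * k + 4))"
  define F6 where "F6 = F_at (X ^ (4 * k + 6))"
  have e: "F_even k = kappa X ^ k * F0" "F_odd k = kappa X ^ k * r * F2"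
    "F_even (Suc k) = kappa X ^ k * kappa X * F4" "F_odd (Suc k) = kappa X ^ k * kappa X * r * F6"
  proof -
    have "4 * Suc k = 4 * k + 4" "4 * Suc k + 2 = 4 * k + 6" by simp_all
    then show "F_even k = kappa X ^ k * F0" "F_odd k = kappa X ^ k * r * F2"
      "F_even (Suc k) = kappa X ^ k * kappa X * F4" "F_odd (Suc k) = kappa X ^ k * kappa X * r * F6"
      by (simp_all only: F_even_def F_odd_def F0_def F2_def F4_def F6_def r_def X_def power_Suc2)
  qed
  have F0: "F0 = (1 - X ^ (4 * k + 3)) * F2 + kappa X * X ^ (4 * k + 4) * F4"
  proof -
    have "2 + 4 * k = 4 * k + 2" "3 + 4 * k = 4 * k + 3" "4 + 4 * k = 4 * k + 4" by simp_all
    with F_at_equation[of "X ^ (4 * k)"] show ?thesis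
      by (simp only: F0_def F2_def F4_def X_def mult.assoc power_add[symmetric])
  qed
  have F2: "F2 = (1 - X ^ (4 * k + 5)) * F4 + kappa X * X ^ (4 * k + 6) * F6"
  proof -
    have "2 + (4 * k + 2) = 4 * k + 4" "3 + (4 * k + 2) = 4 * k + 5" "4 + (4 * k + 2) = 4 * k + 6" by simp_all
    with F_at_equation[of "X ^ (4 * k + 2)"] show ?thesis
      by (simp only: F2_def F4_def F6_def X_def mult.assoc power_add[symmetric])
  qed
  show "F_even k = (1 + fps_X ^ 3) * q_number fps_X (4 * k + 3) * F_odd k + fps_X ^ (4 * k + 4) * F_even (Suc k)"
  proof -
    have "(1 + X ^ 3) * q_number X (4 * k + 3) * (kappa X ^ k * r * F2) = ((1 + X ^ 3) * r) * q_number X (4 * k + 3) * (kappa X ^ k * F2)"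
      by (simp only: mult_ac)
    also have "\<dots> = (1 - X ^ (4 * k + 3)) * (kappa X ^ k * F2)" unfolding r q_number ..
    finally show ?thesis unfolding e X_def[symmetric] F0 by (simp add: algebra_simps)
  qed
  show "F_odd k = (1 + fps_X) * q_number fps_X (4 * k + 5) * F_even (Suc k) + fps_X ^ (4 * k + 6) * F_odd (Suc k)"
  proof -
    have "(1 + X) * q_number X (4 * k + 5) * (kappa X ^ k * kappa X * F4) = ((1 + X) * kappa X) * q_number X (4 * k + 5) * (kappa X ^ k * F4)"
      by (simp only: mult_ac)
    also have "\<dots> = ((1 - X) * q_number X (4 * k + 5)) * r * (kappa X ^ k * F4)" unfolding k[symmetric] by (simp only: mult_ac)
    also have "\<dots> = (1 - X ^ (4 * k + 5)) * r * (kappa X ^ k * F4)" unfolding q_number ..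
    finally show ?thesis unfolding e X_def[symmetric] F2 by (simp add: algebra_simps)
  qed
qed

lemma kappa_fps_nth_0: "fps_nth (kappa (fps_X :: rat fps)) 0 = 1"
  using arg_cong[OF kappa_fps, of "\<lambda>f. fps_nth f 0"] by (simp add: power2_eq_square)

lemma F_even_nth_0: "fps_nth (F_even k) 0 = 1" and F_odd_nth_0: "fps_nth (F_odd k) 0 = 1"
  by (simp_all add: F_even_def F_odd_def kappa_fps_nth_0 F_at_nth_0 fps_power_zeroth fps_divide_unit)

lemma q_neg_cf_exp_1_tendsto:
  "q_neg_cf (\<lambda>j. e_digit (e_state j)) \<longlonglongrightarrow>
     (q_number fps_X 3 * F_even 0 + fps_X ^ 3 * F_odd 0) / (F_even 0 + fps_X\<^sup>2 * F_odd 0)"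
proof -
  define A where "A j = tail_numerator fps_X F_even F_odd (e_state j)" for j
  have "A j = q_number fps_X (e_digit (e_state j)) * A (Suc j)
      - fps_X ^ (e_digit (e_state j) - 1) * A (Suc (Suc j))" for j
    unfolding A_def e_state_Suc
    by (rule tail_numerator_step) (rule F_even_rec F_odd_rec e_state_bound)+
  moreover have "fps_nth (A j) 0 = 1" for j
    by (simp add: A_def tail_numerator_def F_even_nth_0 F_odd_nth_0 power2_eq_square split: prod.split)
  ultimately have "q_neg_cf (\<lambda>j. e_digit (e_state j)) \<longlonglongrightarrow> A 0 / A 1"
    by (rule q_neg_cf_tendsto) (rule e_digit_ge)
  moreover have "A 0 = q_number fps_X 3 * F_even 0 + fps_X ^ 3 * F_odd 0"
    by (simp add: A_def e_state_0 tail_numerator_def q_number_Suc numeral_eq_Suc algebra_simps)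
  moreover have "A 1 = F_even 0 + fps_X\<^sup>2 * F_odd 0"
    by (simp add: A_def e_state_def e_step_def tail_numerator_def)
  ultimately show ?thesis by simp
qed

lemma fps_divide_eq_divide:
  fixes a b c d :: "'a::field fps"
  assumes "fps_nth b 0 \<noteq> 0" "fps_nth d 0 \<noteq> 0" "a * d = c * b"
  shows "a / b = c / d"
proof -
  have "a / b * b = a" "c / d * d = c"
    by (rule dvd_div_mult_self, rule fps_unit_dvd, fact)+
  with assms(3) have "a / b * b * d = c / d * d * b" by (simp only:)
  then have "(a / b) * (b * d) = (c / d) * (b * d)" by (simp only: mult_ac)
  moreover have "b * d \<noteq> 0" using assms(1,2) by auto
  ultimately show ?thesis by (metis mult_right_cancel)
qed

theorem theorem3p5:
  shows "(\<forall>G. fps_nth G 0 = 1 \<and> F_equation G \<longleftrightarrow> G = F_fps)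
    \<and> summable (\<lambda>m. F_coeff (fps_X :: rat fps) m * 1 ^ m)
    \<and> summable (\<lambda>m. F_coeff (fps_X :: rat fps) m * (fps_X\<^sup>2) ^ m)
    \<and> has_q_real (exp 1) (q_real (exp 1))
    \<and> q_real (exp 1) =
        ((1 + fps_X ^ 3) * q_int fps_X 3 * F_at 1 + fps_X ^ 3 * (1 - fps_X) * F_at (fps_X\<^sup>2))
        / ((1 + fps_X ^ 3) * F_at 1 + fps_X\<^sup>2 * (1 - fps_X) * F_at (fps_X\<^sup>2))
    \<and> q_real (exp 1) = (q_int fps_X 3 * R_q + fps_X ^ 3) / (R_q + fps_X\<^sup>2)"
proof -
  define g :: "rat fps" where "g = q_number fps_X 3"
  define u :: "rat fps" where "u = 1 + fps_X ^ 3"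
  define v :: "rat fps" where "v = 1 - fps_X"
  define f where "f = F_at 1"
  define h where "h = F_at (fps_X\<^sup>2)"
  have nth: "fps_nth u 0 = 1" "fps_nth v 0 = 1" "fps_nth f 0 = 1" "fps_nth h 0 = 1"
    by (simp_all add: u_def v_def f_def h_def F_at_nth_0)
  define w where "w = v / u * h"
  have even: "F_even 0 = f" and odd: "F_odd 0 = w"
    by (simp_all add: F_even_def F_odd_def f_def h_def u_def v_def w_def power2_eq_square)
  have "u * (v / u) = v" by (rule dvd_mult_div_cancel) (rule fps_unit_dvd, simp add: nth)
  then have w: "u * w = v * h" by (simp only: w_def mult.assoc[symmetric])
  have w0: "fps_nth w 0 = 1" using arg_cong[OF w, of "\<lambda>f. fps_nth f 0"] by (simp add: nth)
  define r where "r = u / v * (f / h)"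
  have r: "r * (v * h) = u * f"
  proof -
    have "v * (u / v) = u" "h * (f / h) = f"
      by (rule dvd_mult_div_cancel, rule fps_unit_dvd, simp add: nth)+
    moreover have "r * (v * h) = v * (u / v) * (h * (f / h))"
      unfolding r_def by (simp only: mult_ac)
    ultimately show ?thesis by (simp only:)
  qed
  have R: "R_q = r" by (simp add: R_q_def r_def u_def v_def f_def h_def)
  have r0: "fps_nth r 0 = 1" using arg_cong[OF r, of "\<lambda>f. fps_nth f 0"] by (simp add: nth)
  define L where "L = (g * f + fps_X ^ 3 * w) / (f + fps_X\<^sup>2 * w)"
  have lim: "q_neg_cf (\<lambda>j. e_digit (e_state j)) \<longlonglongrightarrow> L"
    using q_neg_cf_exp_1_tendsto unfolding even odd by (simp only: g_def L_def)
  have num: "u * g * f + fps_X ^ 3 * v * h = u * (g * f + fps_X ^ 3 * w)"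
    and den: "u * f + fps_X\<^sup>2 * v * h = u * (f + fps_X\<^sup>2 * w)"
    by (simp_all only: distrib_left mult.left_commute[of u "fps_X ^ _"] w mult.assoc)
  have L1: "L = (u * g * f + fps_X ^ 3 * v * h) / (u * f + fps_X\<^sup>2 * v * h)"
    unfolding num den L_def
    by (rule fps_divide_eq_divide) (simp_all add: nth w0 power2_eq_square mult_ac)
  have num': "u * g * f + fps_X ^ 3 * v * h = (v * h) * (g * r + fps_X ^ 3)"
    and den': "u * f + fps_X\<^sup>2 * v * h = (v * h) * (r + fps_X\<^sup>2)"
    using r by (simp_all add: algebra_simps)
  have L2: "L = (g * r + fps_X ^ 3) / (r + fps_X\<^sup>2)"
    unfolding L1 num' den'
    by (rule fps_divide_eq_divide) (simp_all add: nth r0 power2_eq_square mult_ac)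
  have e: "has_q_real (exp 1) L" "q_real (exp 1) = L"
    using has_q_real_q_real[OF neg_cf_expansion_exp_1 lim] by simp_all
  show ?thesis
    unfolding e(2) R q_int_fps_X
    by (intro conjI allI F_fps_characterization summable_F_at e(1)
        L1[unfolded g_def u_def v_def f_def h_def] L2[unfolded g_def])
qed

end
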